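(* Let $a,b,c,d\in\mathbb{R}$. Then the Matkowski--Sutô equation \[ G_{a,b}(x,y)+G_{c,d}(x,y)=x+y\qquad\text{for all } x,y\in\mathbb{R}_+ \] is satisfied if and only if at least one of the following possibilities holds: (i) $\{a,b\}=\{c,d\}=\{1,0\}$ (so the two means are equal to the arithmetic mean); (ii) there exists $v\in\mathbb{R}$ such that $\{a,b\}=\{1+v,v\}$ and $\{c,d\}=\{1-v,-v\}$; (iii) $\{a,b\}=\{\frac32,\frac12\}$ and $c+d=0$ (in this case, $G_{c,d}$ is the geometric mean); (iv) $a+b=0$ and $\{c,d\}=\{\frac32,\frac12\}$ (in this case, $G_{a,b}$ is the geometric mean).
   Context: $\mathbb{R}_+$ denotes the set of positive real numbers. For $p,q\in\mathbb{R}$, the two-variable Gini mean $G_{p,q}:\mathbb{R}_+^2\to\mathbb{R}_+$ is defined for $x,y\in\mathbb{R}_+$ by \[ G_{p,q}(x,y)=\left(\frac{x^p+y^p}{x^q+y^q}\right)^{\frac{1}{p-q}}\ \text{ if } p\neq q,\qquad G_{p,q}(x,y)=\exp\left(\frac{x^p\ln x+y^p\ln y}{x^p+y^p}\right)\ \text{ if } p=q. \] The arithmetic mean is $(x,y)\mapsto\frac{x+y}{2}$ and the geometric mean is $(x,y)\mapsto\sqrt{xy}$. Braces such as $\{a,b\}$ denote the (unordered) set with elements $a$ and $b$, where $a=b$ is allowed. *)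

theory Defs
  imports Complex_Main
begin

text \<open>The two-variable Gini mean; it is meaningful only for positive \<open>x\<close> and \<open>y\<close>.\<close>

definition gini_mean :: "real \<Rightarrow> real \<Rightarrow> real \<Rightarrow> real \<Rightarrow> real" where
  "gini_mean p q x y =
     (if p \<noteq> q
      then ((x powr p + y powr p) / (x powr q + y powr q)) powr (1 / (p - q))
      else exp ((x powr p * ln x + y powr p * ln y) / (x powr p + y powr p)))"

definition arithmetic_mean :: "real \<Rightarrow> real \<Rightarrow> real" where
  "arithmetic_mean x y = (x + y) / 2"

definition geometric_mean :: "real \<Rightarrow> real \<Rightarrow> real" where
  "geometric_mean x y = sqrt (x * y)"

end

theory Submission
  imports Defs "HOL-Real_Asymp.Real_Asymp"
begin

text \<open>
  Two local analyses suffice for necessity. Near the diagonal, with \<open>x = exp t\<close> and \<open>y = exp (- t)\<close>,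
  comparing the coefficients of \<open>t\<^sup>2\<close> and of the fourth power of \<open>t\<close> gives \<open>a + b + c + d = 2\<close> and one
  cubic relation. Near the boundary, with \<open>x = 1\<close> and \<open>y = u\<close> tending to \<open>0\<close>, the equation reads
  \<open>1 - G\<^bsub>a,b\<^esub>(1,u) = G\<^bsub>c,d\<^esub>(1,u) - u\<close>. When \<open>0 < b \<le> a\<close>, the left-hand side is asymptotic
  to \<open>u powr b / (a - b)\<close>, or to \<open>- (u powr a * ln u)\<close> if \<open>a = b\<close>; the right-hand side is likewise asymptotic to
  an explicit power, or to a power times \<open>- ln u\<close> if \<open>c = d < 0\<close>. Comparing exponents and
  constants together with the two coefficient relations leaves only the listed parameters.
\<close>

lemma gini_mean_commute: "gini_mean p q x y = gini_mean q p x y"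
proof (cases "p = q")
  case False
  have "((x powr p + y powr p) / (x powr q + y powr q)) powr (1 / (p - q))
      = ((x powr q + y powr q) / (x powr p + y powr p)) powr (- (1 / (p - q)))"
    by (metis inverse_divide powr_minus inverse_powr)
  then show ?thesis using False by (auto simp: gini_mean_def minus_divide_right)
qed auto

subsection \<open>Asymptotics at the boundary\<close>

text \<open>As \<open>q < p\<close>, the term \<open>u powr q\<close> dominates
  \<open>u powr p\<close>, so the mean is \<open>1 - u powr q / (p - q)\<close> to leading
  order.\<close>

lemma gini_at_0_pos_neq:
  assumes "0 < q" "q < p"
  shows "((\<lambda>u. (1 - gini_mean p q 1 u) / u powr q) \<longlongrightarrow> 1 / (p - q)) (at_right 0)"
  using assms unfolding gini_mean_def by simp real_asymp

text \<open>The logarithm of the mean is \<open>u powr p * ln u / (1 + u powr p)\<close>. The sign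
  in the weight makes it positive for \<open>u < 1\<close>.\<close>

lemma gini_at_0_pos_eq:
  assumes "0 < p"
  shows "((\<lambda>u. (1 - gini_mean p p 1 u) / (- (u powr p * ln u))) \<longlongrightarrow> 1) (at_right 0)"
  using assms unfolding gini_mean_def by simp real_asymp

text \<open>The zero parameter makes the denominator the constant 2. The resulting limit lies
  strictly between 0 and 1, which distinguishes this case from the limits 1 and 0 found for other
  signs.\<close>

lemma gini_at_0_pos_zero:
  assumes "0 < p"
  shows "((\<lambda>u. gini_mean p 0 1 u) \<longlongrightarrow> 2 powr (- 1 / p)) (at_right 0)"
proof -
  have "((\<lambda>u. ((1 + u powr p) / 2) powr (1 / p)) \<longlongrightarrow> (1/2) powr (1/p)) (at_right 0)"
    using assms by real_asymp
  moreover have "\<forall>\<^sub>F u in at_right 0. gini_mean p 0 1 u = ((1 + u powr p) / 2) powr (1 / p)"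
    using eventually_at_right_less[of 0] by eventually_elim (use assms in \<open>auto simp: gini_mean_def\<close>)
  moreover have "(1/2) powr (1/p) = 2 powr (- 1 / p)"
    by (simp add: powr_minus powr_divide field_simps)
  ultimately show ?thesis by (simp add: tendsto_cong)
qed

text \<open>Here \<open>u powr q\<close> blows up. Pulling \<open>u powr (-q)\<close> out of the
  quotient leaves a factor tending to 1, and the subtracted \<open>u\<close> is of smaller order
  because \<open>u = u powr (-q / (p - q)) * u powr (p / (p - q))\<close> and
  \<open>p / (p - q) > 0\<close>.\<close>

lemma gini_at_0_mixed:
  assumes "q < 0" "0 < p"
  shows "((\<lambda>u. (gini_mean p q 1 u - u) / u powr (- q / (p - q))) \<longlongrightarrow> 1) (at_right 0)"
proof -
  have A: "\<forall>\<^sub>F u in at_right 0. (gini_mean p q 1 u - u) / u powr (- q / (p - q)) =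
     ((1 + u powr p) / (1 + u powr (-q))) powr (1 / (p - q)) - u powr (p / (p - q))"
    using eventually_at_right_less[of 0]
  proof eventually_elim
    case (elim u)
    have "(1 + u powr p) / (1 + u powr q) = u powr (-q) * ((1 + u powr p) / (1 + u powr (-q)))"
      using elim by (simp add: powr_minus divide_simps add_pos_pos)
    then have "gini_mean p q 1 u = (u powr (-q) * ((1 + u powr p) / (1 + u powr (-q)))) powr (1 / (p - q))"
      using assms by (simp add: gini_mean_def)
    also have "\<dots> = (u powr (-q)) powr (1 / (p - q)) * ((1 + u powr p) / (1 + u powr (-q))) powr (1 / (p - q))"
      by (intro powr_mult)
    also have "(u powr (-q)) powr (1 / (p - q)) = u powr (-q / (p - q))"
      by (simp add: powr_powr)
    finally have "gini_mean p q 1 u = u powr (-q / (p - q)) * ((1 + u powr p) / (1 + u powr (-q))) powr (1 / (p - q))" .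
    moreover have "u powr (-q / (p - q)) * u powr (p / (p - q)) = u"
    proof -
      have "-q / (p - q) + p / (p - q) = 1"
        using assms by (simp add: divide_simps)
      then show ?thesis using elim by (simp flip: powr_add)
    qed
    ultimately have "gini_mean p q 1 u - u = u powr (-q / (p - q)) *
        (((1 + u powr p) / (1 + u powr (-q))) powr (1 / (p - q)) - u powr (p / (p - q)))"
      by (simp only: right_diff_distrib)
    then show ?case using elim by simp
  qed
  have B: "((\<lambda>u. ((1 + u powr p) / (1 + u powr (-q))) powr (1 / (p - q)) - u powr (p / (p - q))) \<longlongrightarrow> 1) (at_right 0)"
  proof -
    have "((\<lambda>u. ((1 + u powr p) / (1 + u powr (-q))) powr (1 / (p - q))) \<longlongrightarrow> 1) (at_right 0)"
      using assms by real_asymp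
    moreover have "0 < p / (p - q)" using assms by simp
    then have "((\<lambda>u. u powr (p / (p - q))) \<longlongrightarrow> 0) (at_right 0)"
      by real_asymp
    ultimately show ?thesis using tendsto_diff by fastforce
  qed
  show ?thesis using B A by (simp add: tendsto_cong)
qed

lemma gini_mean_pos: "x > 0 \<Longrightarrow> y > 0 \<Longrightarrow> gini_mean p q x y > 0"
  using add_pos_pos[of "x powr p" "y powr p"] add_pos_pos[of "x powr q" "y powr q"]
  by (auto simp: gini_mean_def)

text \<open>Negating both parameters conjugates the mean by M \<mapsto> x y / M. This carries the
  asymptotics for positive parameters over to negative ones.\<close>

lemma gini_mean_uminus:
  assumes "0 < u"
  shows "gini_mean (-p) (-q) 1 u = u / gini_mean p q 1 u"
proof (cases "p = q")
  case True
  have "1 + u powr p > 0" by (simp add: add_pos_nonneg)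
  then have "(u powr (-p) * ln u) / (1 + u powr (-p)) + (u powr p * ln u) / (1 + u powr p) = ln u"
    using assms by (simp add: powr_minus divide_simps) (auto simp: algebra_simps)
  then have "exp ((u powr (-p) * ln u) / (1 + u powr (-p))) * exp ((u powr p * ln u) / (1 + u powr p)) = u"
    using assms by (simp flip: exp_add)
  then show ?thesis using True by (simp add: gini_mean_def field_simps)
next
  case False
  define H where "H = (1 + u powr p) / (1 + u powr q)"
  have pos: "1 + u powr p > 0" "1 + u powr q > 0" by (simp_all add: add_pos_nonneg)
  have "(1 + u powr (-p)) / (1 + u powr (-q)) = u powr (q - p) * H"
    using assms pos by (simp add: H_def powr_minus powr_diff divide_simps) (auto simp: algebra_simps)
  moreover have "(u powr (q - p) * H) powr (1 / (q - p)) = u * H powr (1 / (q - p))"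
    using assms False by (simp add: powr_mult powr_powr)
  moreover have "H powr (1 / (q - p)) = 1 / H powr (1 / (p - q))"
    by (metis minus_diff_eq minus_divide_right powr_minus_divide)
  ultimately show ?thesis
    using False by (simp add: gini_mean_def H_def)
qed

text \<open>Since \<open>u / H - u = u * (1 - H) / H\<close> and \<open>H\<close> tends to 1, the
  reflected mean deviates from \<open>u\<close> at the rate at which \<open>H\<close> deviates from
  1, multiplied by \<open>u\<close>.\<close>

lemma reflected_at_0:
  fixes w H :: "real \<Rightarrow> real"
  assumes "((\<lambda>u. (1 - H u) / w u) \<longlongrightarrow> l) (at_right 0)" "(w \<longlongrightarrow> 0) (at_right 0)"
    and "\<forall>\<^sub>F u in at_right 0. w u \<noteq> 0"
  shows "(H \<longlongrightarrow> 1) (at_right 0)"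
    and "((\<lambda>u. (u / H u - u) / (u * w u)) \<longlongrightarrow> l) (at_right 0)"
proof -
  have "((\<lambda>u. 1 - (1 - H u) / w u * w u) \<longlongrightarrow> 1 - l * 0) (at_right 0)"
    by (intro tendsto_intros assms)
  moreover have "\<forall>\<^sub>F u in at_right 0. 1 - (1 - H u) / w u * w u = H u"
    using assms(3) by eventually_elim simp
  ultimately show H: "(H \<longlongrightarrow> 1) (at_right 0)"
    by (simp add: tendsto_cong)
  have "((\<lambda>u. (1 - H u) / w u / H u) \<longlongrightarrow> l / 1) (at_right 0)"
    by (intro tendsto_intros assms H) simp
  moreover have "\<forall>\<^sub>F u in at_right 0. (u / H u - u) / (u * w u) = (1 - H u) / w u / H u"
    using assms(3) eventually_at_right_less[of 0] order_tendstoD(1)[OF H zero_less_one]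
    by eventually_elim (simp add: divide_simps, simp add: algebra_simps)
  ultimately show "((\<lambda>u. (u / H u - u) / (u * w u)) \<longlongrightarrow> l) (at_right 0)"
    by (simp add: tendsto_cong)
qed

lemma gini_at_0_neg_neq:
  assumes "q < p" "p < 0"
  shows "((\<lambda>u. (gini_mean p q 1 u - u) / u powr (1 - p)) \<longlongrightarrow> 1 / (p - q)) (at_right 0)"
proof -
  have "((\<lambda>u. u powr (-p)) \<longlongrightarrow> 0) (at_right 0)"
    using assms by real_asymp
  moreover have "\<forall>\<^sub>F u in at_right 0. u powr (-p) \<noteq> 0"
    using eventually_at_right_less[of 0] by eventually_elim simp
  ultimately have "((\<lambda>u. (u / gini_mean (-q) (-p) 1 u - u) / (u * u powr (-p))) \<longlongrightarrow> 1 / (p - q)) (at_right 0)"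
    using reflected_at_0(2)[OF gini_at_0_pos_neq[of "-p" "-q"]] assms by simp
  moreover have "\<forall>\<^sub>F u in at_right 0. (u / gini_mean (-q) (-p) 1 u - u) / (u * u powr (-p))
      = (gini_mean p q 1 u - u) / u powr (1 - p)"
    using eventually_at_right_less[of 0]
    by eventually_elim
      (simp add: gini_mean_commute[of "-q"] gini_mean_uminus powr_diff powr_minus field_simps)
  ultimately show ?thesis by (simp add: tendsto_cong)
qed

lemma gini_at_0_neg_eq:
  assumes "p < 0"
  shows "((\<lambda>u. (gini_mean p p 1 u - u) / (- (u powr (1 - p) * ln u))) \<longlongrightarrow> 1) (at_right 0)"
proof -
  have "((\<lambda>u. - (u powr (-p) * ln u)) \<longlongrightarrow> 0) (at_right 0)"
    using assms by real_asymp
  moreover have "\<forall>\<^sub>F u in at_right 0. - (u powr (-p) * ln u) \<noteq> 0"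
    using eventually_at_right_real[OF zero_less_one] by eventually_elim simp
  ultimately have "((\<lambda>u. (u / gini_mean (-p) (-p) 1 u - u) / (u * - (u powr (-p) * ln u))) \<longlongrightarrow> 1) (at_right 0)"
    using reflected_at_0(2)[OF gini_at_0_pos_eq[of "-p"]] assms by simp
  moreover have "\<forall>\<^sub>F u in at_right 0. (u / gini_mean (-p) (-p) 1 u - u) / (u * - (u powr (-p) * ln u))
      = (gini_mean p p 1 u - u) / (- (u powr (1 - p) * ln u))"
    using eventually_at_right_less[of 0]
    by eventually_elim
      (simp add: gini_mean_uminus powr_diff powr_minus field_simps)
  ultimately show ?thesis by (rule Lim_transform_eventually)
qed

text \<open>By reflection, the quotient is \<open>1 / gini_mean (-q) 0 1 u - 1\<close>. Writing
  \<open>u powr 1\<close> makes the weight an instance of \<open>u powr (1 - p)\<close> with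
  \<open>p = 0\<close>.\<close>

lemma gini_at_0_zero_neg:
  assumes "q < 0"
  shows "((\<lambda>u. (gini_mean 0 q 1 u - u) / u powr 1) \<longlongrightarrow> 2 powr (- 1 / q) - 1) (at_right 0)"
proof -
  have "((\<lambda>u. 1 / gini_mean (-q) 0 1 u - 1) \<longlongrightarrow> 1 / 2 powr (- 1 / (-q)) - 1) (at_right 0)"
    using assms by (intro tendsto_intros gini_at_0_pos_zero) auto
  moreover have "1 / 2 powr (- 1 / (-q)) = 2 powr (- 1 / q)"
    by (simp add: powr_minus field_simps)
  moreover have "\<forall>\<^sub>F u in at_right 0. 1 / gini_mean (-q) 0 1 u - 1 = (gini_mean 0 q 1 u - u) / u powr 1"
    using eventually_at_right_less[of 0]
  proof eventually_elim
    case (elim u)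
    then show ?case
      using gini_mean_uminus[of u "-q" 0] gini_mean_pos[of 1 u "-q" 0]
      by (simp add: gini_mean_commute[of 0] field_simps)
  qed
  ultimately show ?thesis by (simp add: tendsto_cong)
qed

lemma gini_at_0_zero_zero:
  "((\<lambda>u. (gini_mean 0 0 1 u - u) / u powr (1/2)) \<longlongrightarrow> 1) (at_right 0)"
proof -
  have "((\<lambda>u::real. (exp (ln u / 2) - u) / u powr (1/2)) \<longlongrightarrow> 1) (at_right 0)"
    by real_asymp
  moreover have "\<forall>\<^sub>F u in at_right 0. (exp (ln u / 2) - u) / u powr (1/2) = (gini_mean 0 0 1 u - u) / u powr (1/2)"
    using eventually_at_right_less[of 0] by eventually_elim (simp add: gini_mean_def)
  ultimately show ?thesis by (rule Lim_transform_eventually)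
qed

subsection \<open>Expansion at the diagonal\<close>

text \<open>Rescaling s = p t in ln cosh s = s^2/2 - s^4/12 + ...; the case \<open>p = 0\<close> is
  separate because this substitution is then constant.\<close>

lemma ln_cosh_expansion:
  "((\<lambda>t. (ln (cosh (p * t)) - p^2 * t^2 / 2) / t^4) \<longlongrightarrow> - (p^4) / 12) (at (0::real))"
proof (cases "p = 0")
  case False
  have *: "((\<lambda>s. (ln (cosh s) - s^2/2) / s^4) \<longlongrightarrow> -1/12) (at (0::real))"
    by real_asymp
  have "filterlim (\<lambda>t. p * t) (at 0) (at 0)"
    using False by (auto simp: filterlim_at eventually_at_filter intro!: tendsto_eq_intros)
  from tendsto_mult_left[OF filterlim_compose[OF * this], of "p^4"] show ?thesis
    using False by (simp add: power_mult_distrib)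
qed simp

lemma tanh_expansion:
  "((\<lambda>t. (t * tanh (p * t) - p * t^2) / t^4) \<longlongrightarrow> - (p^3) / 3) (at (0::real))"
proof (cases "p = 0")
  case False
  have *: "((\<lambda>s. (s * tanh s - s^2) / s^4) \<longlongrightarrow> -1/3) (at (0::real))"
    unfolding tanh_def by real_asymp
  have "filterlim (\<lambda>t. p * t) (at 0) (at 0)"
    using False by (auto simp: filterlim_at eventually_at_filter intro!: tendsto_eq_intros)
  from tendsto_mult_left[OF filterlim_compose[OF * this], of "p^3"]
  have "((\<lambda>t. p^3 * ((p * t * tanh (p * t) - (p * t)^2) / (p * t)^4)) \<longlongrightarrow> - (p^3) / 3) (at 0)"
    by simp
  moreover have "p^3 * ((p * t * tanh (p * t) - (p * t)^2) / (p * t)^4) = (t * tanh (p * t) - p * t^2) / t^4" for t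
  proof -
    have "p * t * tanh (p * t) - (p * t)^2 = p * (t * tanh (p * t) - p * t^2)" "(p * t)^4 = p * p^3 * t^4"
      by (simp_all add: algebra_simps power_mult_distrib power2_eq_square power3_eq_cube power4_eq_xxxx)
    then show ?thesis using False by simp
  qed
  ultimately show ?thesis by simp
qed simp

text \<open>Passes from an expansion of the logarithm of a mean to one of the mean itself: in exp A
  = 1 + A + A^2/2 + ..., only the square of the leading term of A reaches order t^4.\<close>

lemma exp_expansion:
  fixes A :: "real \<Rightarrow> real"
  assumes "((\<lambda>t. (A t - \<alpha> * t^2) / t^4) \<longlongrightarrow> \<beta>) (at 0)"
  shows "((\<lambda>t. (exp (A t) - 1 - \<alpha> * t^2) / t^4) \<longlongrightarrow> \<beta> + \<alpha>^2 / 2) (at 0)"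
proof -
  \<comment> \<open>The continuous extension by 1/2 gives exp s - 1 - s = \<phi>(s) s^2 for every s.
    This matters because \<open>A t\<close> may vanish away from \<open>t = 0\<close>, as it does
    for the geometric mean.\<close>
  define \<phi> where "\<phi> = (\<lambda>s::real. if s = 0 then 1/2 else (exp s - 1 - s) / s^2)"
  have "((\<lambda>s. (exp s - 1 - s) / s^2) \<longlongrightarrow> 1/2) (at (0::real))"
    by real_asymp
  then have \<phi>: "isCont \<phi> 0"
    unfolding isCont_def \<phi>_def by (simp cong: LIM_cong)
  have A2: "((\<lambda>t. A t / t^2) \<longlongrightarrow> \<alpha>) (at 0)"
  proof -
    have "((\<lambda>t. (A t - \<alpha> * t^2) / t^4 * t^2 + \<alpha>) \<longlongrightarrow> \<beta> * 0^2 + \<alpha>) (at 0)"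
      by (intro tendsto_intros assms)
    moreover have "\<forall>\<^sub>F t in at 0. (A t - \<alpha> * t^2) / t^4 * t^2 + \<alpha> = A t / t^2"
      by (auto simp: eventually_at_filter field_simps power4_eq_xxxx power2_eq_square)
    ultimately show ?thesis by (simp add: tendsto_cong)
  qed
  have A0: "(A \<longlongrightarrow> 0) (at 0)"
  proof -
    have "((\<lambda>t. A t / t^2 * t^2) \<longlongrightarrow> \<alpha> * 0^2) (at 0)"
      by (intro tendsto_intros A2)
    moreover have "\<forall>\<^sub>F t in at 0. A t / t^2 * t^2 = A t"
      by (auto simp: eventually_at_filter)
    ultimately show ?thesis by (simp add: tendsto_cong)
  qed
  have "((\<lambda>t. (A t - \<alpha> * t^2) / t^4 + \<phi> (A t) * (A t / t^2)^2) \<longlongrightarrow> \<beta> + \<phi> 0 * \<alpha>^2) (at 0)"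
    by (intro tendsto_intros assms A2 isCont_tendsto_compose[OF \<phi> A0])
  moreover have "\<forall>\<^sub>F t in at 0. (A t - \<alpha> * t^2) / t^4 + \<phi> (A t) * (A t / t^2)^2 = (exp (A t) - 1 - \<alpha> * t^2) / t^4"
  proof -
    have "(A t - \<alpha> * t^2) / t^4 + \<phi> (A t) * (A t / t^2)^2 = (exp (A t) - 1 - \<alpha> * t^2) / t^4" for t
    proof -
      have "\<phi> (A t) * (A t)^2 = exp (A t) - 1 - A t" by (simp add: \<phi>_def)
      moreover have "\<phi> (A t) * (A t / t^2)^2 = (\<phi> (A t) * (A t)^2) / t^4"
        by (simp add: power_divide flip: power_mult)
      ultimately show ?thesis by (simp flip: add_divide_distrib)
    qed
    then show ?thesis by simp
  qed
  ultimately show ?thesis by (simp add: tendsto_cong \<phi>_def)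
qed

text \<open>With x y = 1, each power sum is \<open>2 * cosh (r * t)\<close>.\<close>

lemma gini_mean_exp:
  "gini_mean p q (exp t) (exp (- t)) =
    exp (if p = q then t * tanh (p * t) else (ln (cosh (p * t)) - ln (cosh (q * t))) / (p - q))"
proof -
  have c: "exp t powr r + exp (- t) powr r = 2 * cosh (r * t)" for r
    by (simp add: exp_powr_real cosh_def field_simps)
  show ?thesis
  proof (cases "p = q")
    case True
    have "exp t powr p * t - exp (-t) powr p * t = t * (2 * sinh (p * t))"
      by (simp add: exp_powr_real sinh_def field_simps)
    then show ?thesis using True
      by (simp add: gini_mean_def c tanh_def)
  next
    case False
    have "gini_mean p q (exp t) (exp (- t)) = (cosh (p * t) / cosh (q * t)) powr (1 / (p - q))"
      using False by (simp add: gini_mean_def c)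
    also have "cosh (p * t) / cosh (q * t) = exp (ln (cosh (p * t)) - ln (cosh (q * t)))"
      by (simp add: exp_diff cosh_real_pos)
    also have "\<dots> powr (1 / (p - q)) = exp ((ln (cosh (p * t)) - ln (cosh (q * t))) / (p - q))"
      by (simp add: exp_powr_real)
    finally show ?thesis using False by simp
  qed
qed

text \<open>For \<open>p \<noteq> q\<close> the t^4 coefficient of the logarithm is the difference
  quotient of -p^4/12, that is, -(p + q)(p^2 + q^2)/12. At \<open>p = q\<close> this formula gives
  the derivative -p^3/3, so both branches of the definition share one expansion.\<close>

lemma gini_mean_expansion:
  "((\<lambda>t. (gini_mean p q (exp t) (exp (- t)) - 1 - (p + q) / 2 * t^2) / t^4) \<longlongrightarrow>
    (p + q)^2 / 8 - (p + q) * (p^2 + q^2) / 12) (at 0)"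
proof -
  have "((\<lambda>t. ((if p = q then t * tanh (p * t) else (ln (cosh (p * t)) - ln (cosh (q * t))) / (p - q))
      - (p + q) / 2 * t^2) / t^4) \<longlongrightarrow> - (p + q) * (p^2 + q^2) / 12) (at 0)"
  proof (cases "p = q")
    case True
    then show ?thesis using tanh_expansion[of p] by (simp add: power3_eq_cube power2_eq_square field_simps)
  next
    case False
    have "((\<lambda>t. ((ln (cosh (p * t)) - p^2 * t^2 / 2) / t^4 - (ln (cosh (q * t)) - q^2 * t^2 / 2) / t^4) / (p - q)) \<longlongrightarrow>
      (- (p^4) / 12 - (- (q^4) / 12)) / (p - q)) (at 0)"
      using False by (intro tendsto_intros ln_cosh_expansion) auto
    moreover have "(- (p^4) / 12 - (- (q^4) / 12)) / (p - q) = - (p + q) * (p^2 + q^2) / 12"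
      using False by (simp add: divide_simps) (simp add: algebra_simps power2_eq_square power4_eq_xxxx)
    moreover have "((ln (cosh (p * t)) - p^2 * t^2 / 2) / t^4 - (ln (cosh (q * t)) - q^2 * t^2 / 2) / t^4) / (p - q)
      = ((ln (cosh (p * t)) - ln (cosh (q * t))) / (p - q) - (p + q) / 2 * t^2) / t^4" for t
      using False by (simp add: divide_simps) (simp add: algebra_simps power2_eq_square)
    ultimately show ?thesis using False by (simp only: if_False)
  qed
  from exp_expansion[OF this] show ?thesis
    unfolding gini_mean_exp by (simp add: power_divide field_simps)
qed

lemma matkowski_suto_coefficients:
  assumes eq: "\<And>x y. x > 0 \<Longrightarrow> y > 0 \<Longrightarrow> gini_mean a b x y + gini_mean c d x y = x + y"
  shows "a + b + c + d = 2"
    and "(a + b)^2 / 8 - (a + b) * (a^2 + b^2) / 12 + ((c + d)^2 / 8 - (c + d) * (c^2 + d^2) / 12) = 1 / 12"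
      (is "?k = _")
proof -
  define \<alpha> where "\<alpha> = (a + b) / 2 + (c + d) / 2"
  have "((\<lambda>t. (gini_mean a b (exp t) (exp (- t)) - 1 - (a + b) / 2 * t^2) / t^4 +
      (gini_mean c d (exp t) (exp (- t)) - 1 - (c + d) / 2 * t^2) / t^4) \<longlongrightarrow> ?k) (at 0)"
    by (intro tendsto_add gini_mean_expansion)
  moreover have "(gini_mean a b (exp t) (exp (- t)) - 1 - (a + b) / 2 * t^2) / t^4 +
      (gini_mean c d (exp t) (exp (- t)) - 1 - (c + d) / 2 * t^2) / t^4
      = (2 * cosh t - 2 - \<alpha> * t^2) / t^4" for t
  proof -
    have "gini_mean c d (exp t) (exp (- t)) = 2 * cosh t - gini_mean a b (exp t) (exp (- t))"
      using eq[of "exp t" "exp (-t)"] by (simp add: cosh_def field_simps)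
    then show ?thesis by (simp add: \<alpha>_def algebra_simps flip: add_divide_distrib)
  qed
  ultimately have k: "((\<lambda>t. (2 * cosh t - 2 - \<alpha> * t^2) / t^4) \<longlongrightarrow> ?k) (at 0)" by simp
  have c: "((\<lambda>t. (2 * cosh t - 2 - t^2) / t^4) \<longlongrightarrow> 1/12) (at (0::real))"
    by real_asymp
  \<comment> \<open>Both quotients converge, so t^2 times their difference tends to 0; but this
    product is the constant 1 - \<alpha>.\<close>
  have "((\<lambda>t. ((2 * cosh t - 2 - \<alpha> * t^2) / t^4 - (2 * cosh t - 2 - t^2) / t^4) * t^2) \<longlongrightarrow> (?k - 1/12) * 0^2) (at 0)"
    by (intro tendsto_intros k c)
  moreover have "\<forall>\<^sub>F t in at 0. ((2 * cosh t - 2 - \<alpha> * t^2) / t^4 - (2 * cosh t - 2 - t^2) / t^4) * t^2 = 1 - \<alpha>"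
  proof -
    have "((2 * cosh t - 2 - \<alpha> * t^2) / t^4 - (2 * cosh t - 2 - t^2) / t^4) * t^2 = 1 - \<alpha>"
      if "t \<noteq> 0" for t :: real
    proof -
      have "(2 * cosh t - 2 - \<alpha> * t^2) / t^4 - (2 * cosh t - 2 - t^2) / t^4 = (1 - \<alpha>) * t^2 / t^4"
        by (simp add: algebra_simps flip: diff_divide_distrib)
      then show ?thesis using that by (simp add: power4_eq_xxxx power2_eq_square)
    qed
    then show ?thesis by (simp add: eventually_at_filter)
  qed
  ultimately have "((\<lambda>t::real. 1 - \<alpha>) \<longlongrightarrow> 0) (at 0)" by (simp add: tendsto_cong)
  then have \<alpha>: "\<alpha> = 1" by (simp add: tendsto_const_iff)
  then show "a + b + c + d = 2" by (simp add: \<alpha>_def field_simps)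
  show "?k = 1/12" using tendsto_unique[OF _ k] c \<alpha> by simp
qed

subsection \<open>Comparison of exponents\<close>

text \<open>The two quotients differ by a power of \<open>u\<close>. If the exponents differed, one
  limit would be the other times 0, contradicting that both are nonzero.\<close>

lemma powr_comparison:
  fixes f :: "real \<Rightarrow> real"
  assumes "((\<lambda>u. f u / u powr x) \<longlongrightarrow> l) (at_right 0)" "((\<lambda>u. f u / u powr y) \<longlongrightarrow> m) (at_right 0)"
    and "l \<noteq> 0" "m \<noteq> 0"
  shows "x = y \<and> l = m"
proof -
  have *: False if "x < y" "((\<lambda>u. f u / u powr x) \<longlongrightarrow> l) (at_right 0)"
    "((\<lambda>u. f u / u powr y) \<longlongrightarrow> m) (at_right 0)" "l \<noteq> 0" for x y l m
  proof -
    have "((\<lambda>u::real. u powr (y - x)) \<longlongrightarrow> 0) (at_right 0)"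
      using that(1) by real_asymp
    from tendsto_mult[OF that(3) this] have "((\<lambda>u. f u / u powr y * u powr (y - x)) \<longlongrightarrow> 0) (at_right 0)"
      by simp
    moreover have "\<forall>\<^sub>F u in at_right 0. f u / u powr y * u powr (y - x) = f u / u powr x"
      using eventually_at_right_less[of 0] by eventually_elim (simp add: powr_diff)
    ultimately have "((\<lambda>u. f u / u powr x) \<longlongrightarrow> 0) (at_right 0)" by (simp add: tendsto_cong)
    from tendsto_unique[OF _ that(2) this] show False using that(4) by simp
  qed
  have "x = y" using *[of x y l m] *[of y x m l] assms by force
  moreover then have "l = m" using tendsto_unique[OF _ assms(1)] assms(2) by force
  ultimately show ?thesis by simp
qed

text \<open>A logarithmic factor is never compensated by a power: for \<open>x < y\<close> the
  factor \<open>u powr (y - x) * ln u\<close> tends to 0 and forces \<open>l = 0\<close>; otherwise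
  \<open>u powr (x - y) / ln u\<close> tends to 0 and forces \<open>m = 0\<close>.\<close>

lemma powr_ln_comparison:
  fixes f :: "real \<Rightarrow> real"
  assumes f: "((\<lambda>u. f u / u powr x) \<longlongrightarrow> l) (at_right 0)"
    and g: "((\<lambda>u. f u / (- (u powr y * ln u))) \<longlongrightarrow> m) (at_right 0)"
    and "l \<noteq> 0" "m \<noteq> 0"
  shows False
proof (cases "x < y")
  case True
  then have "((\<lambda>u::real. - (u powr (y - x) * ln u)) \<longlongrightarrow> 0) (at_right 0)"
    by real_asymp
  from tendsto_mult[OF g this] have "((\<lambda>u. f u / (- (u powr y * ln u)) * - (u powr (y - x) * ln u)) \<longlongrightarrow> 0) (at_right 0)"
    by simp
  moreover have "\<forall>\<^sub>F u in at_right 0. f u / (- (u powr y * ln u)) * - (u powr (y - x) * ln u) = f u / u powr x"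
    using eventually_at_right_real[OF zero_less_one] by eventually_elim (simp add: powr_diff)
  ultimately have "((\<lambda>u. f u / u powr x) \<longlongrightarrow> 0) (at_right 0)" by (rule Lim_transform_eventually)
  from tendsto_unique[OF _ f this] show False using \<open>l \<noteq> 0\<close> by simp
next
  case False
  have "((\<lambda>u::real. - (u powr (x - y) / ln u)) \<longlongrightarrow> 0) (at_right 0)"
  proof (cases "x = y")
    case True
    have "((\<lambda>u::real. - (1 / ln u)) \<longlongrightarrow> 0) (at_right 0)" by real_asymp
    moreover have "\<forall>\<^sub>F u in at_right 0. - (1 / ln u) = - (u powr (x - y) / ln u)"
      using eventually_at_right_less[of 0] by eventually_elim (simp add: True)
    ultimately show ?thesis by (rule Lim_transform_eventually)
  next
    case 2: False
    with False have "x > y" by simp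
    then show ?thesis by real_asymp
  qed
  from tendsto_mult[OF f this] have "((\<lambda>u. f u / u powr x * - (u powr (x - y) / ln u)) \<longlongrightarrow> 0) (at_right 0)"
    by simp
  moreover have "\<forall>\<^sub>F u in at_right 0. f u / u powr x * - (u powr (x - y) / ln u) = f u / (- (u powr y * ln u))"
    using eventually_at_right_real[OF zero_less_one] by eventually_elim (simp add: powr_diff)
  ultimately have "((\<lambda>u. f u / (- (u powr y * ln u))) \<longlongrightarrow> 0) (at_right 0)" by (rule Lim_transform_eventually)
  from tendsto_unique[OF _ g this] show False using \<open>m \<noteq> 0\<close> by simp
qed

section \<open>Limits and leading terms at the boundary, by signs of the parameters\<close>

lemma gini_at_0_pos:
  assumes "0 < q" "q \<le> p"
  shows "((\<lambda>u. gini_mean p q 1 u) \<longlongrightarrow> 1) (at_right 0)"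
proof (cases "p = q")
  case True
  have "((\<lambda>u. - (u powr p * ln u)) \<longlongrightarrow> 0) (at_right 0)"
    using assms by real_asymp
  moreover have "\<forall>\<^sub>F u in at_right 0. - (u powr p * ln u) \<noteq> 0"
    using eventually_at_right_real[OF zero_less_one] by eventually_elim simp
  ultimately show ?thesis
    using reflected_at_0(1)[OF gini_at_0_pos_eq] assms True by simp
next
  case False
  have "((\<lambda>u. u powr q) \<longlongrightarrow> 0) (at_right 0)"
    using assms by real_asymp
  moreover have "\<forall>\<^sub>F u in at_right 0. u powr q \<noteq> 0"
    using eventually_at_right_less[of 0] by eventually_elim simp
  ultimately show ?thesis
    using reflected_at_0(1)[OF gini_at_0_pos_neq] assms False by simp
qed

text \<open>The second hypothesis describes exactly the sorted pairs outside
  \<open>0 \<le> q\<close>, \<open>0 < p\<close>. The last power alternative merges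
  \<open>p = 0\<close> with \<open>p < 0\<close> and leaves \<open>l\<close> open, since there the
  exponent alone will be combined with the coefficient relations.\<close>

lemma gini_minus_id_cases:
  assumes "q \<le> p" "q < 0 \<or> p = 0"
  obtains (powr) x l where "((\<lambda>u. (gini_mean p q 1 u - u) / u powr x) \<longlongrightarrow> l) (at_right 0)"
      "l \<noteq> 0" "0 < x"
      "q < 0 \<and> 0 < p \<and> x = - q / (p - q) \<and> l = 1 \<or> p = 0 \<and> q = 0 \<and> x = 1 / 2 \<and> l = 1 \<or>
       q < p \<and> p \<le> 0 \<and> x = 1 - p"
  | (ln) "p = q" "p < 0"
      "((\<lambda>u. (gini_mean p q 1 u - u) / (- (u powr (1 - p) * ln u))) \<longlongrightarrow> 1) (at_right 0)"
proof -
  consider "q < 0" "0 < p" | "p = 0" "q = 0" | "p = 0" "q < 0" | "q < p" "p < 0" | "p = q" "p < 0"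
    using assms by linarith
  then show ?thesis
  proof cases
    case 1
    then show ?thesis by (intro powr[OF gini_at_0_mixed]) (auto simp: divide_neg_pos)
  next
    case 2
    then show ?thesis using gini_at_0_zero_zero by (intro powr[of "1/2" 1]) auto
  next
    case 3
    \<comment> \<open>Ensures that the leading coefficient \<open>2 powr (- 1 / q) - 1\<close> is
      nonzero.\<close>
    then have "- 1 / q > 0" by (simp add: divide_neg_neg)
    then have "(2::real) powr (- 1 / q) > 2 powr 0" by (subst powr_less_cancel_iff) auto
    then show ?thesis using 3 gini_at_0_zero_neg[of q] by (intro powr[of 1 "2 powr (- 1 / q) - 1"]) auto
  next
    case 4
    then show ?thesis by (intro powr[OF gini_at_0_neg_neq]) auto
  next
    case 5
    then show ?thesis using gini_at_0_neg_eq[of p] by (intro ln) auto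
  qed
qed

lemma gini_at_0_nonpos:
  assumes "q \<le> p" "q < 0 \<or> p = 0"
  shows "((\<lambda>u. gini_mean p q 1 u) \<longlongrightarrow> 0) (at_right 0)"
proof -
  have *: ?thesis if lim: "((\<lambda>u. (gini_mean p q 1 u - u) / w u) \<longlongrightarrow> l) (at_right 0)"
    and w: "(w \<longlongrightarrow> 0) (at_right 0)" "\<forall>\<^sub>F u in at_right 0. w u \<noteq> 0" for w l
  proof -
    have "((\<lambda>u. (gini_mean p q 1 u - u) / w u * w u + u) \<longlongrightarrow> l * 0 + 0) (at_right 0)"
      by (intro tendsto_intros lim w)
    moreover have "\<forall>\<^sub>F u in at_right 0. (gini_mean p q 1 u - u) / w u * w u + u = gini_mean p q 1 u"
      using w(2) by eventually_elim simp
    ultimately show ?thesis by (simp add: tendsto_cong)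
  qed
  from assms show ?thesis
  proof (cases rule: gini_minus_id_cases)
    case (powr x l)
    have "((\<lambda>u. u powr x) \<longlongrightarrow> 0) (at_right 0)"
      using powr(3) by real_asymp
    moreover have "\<forall>\<^sub>F u in at_right 0. u powr x \<noteq> 0"
      using eventually_at_right_less[of 0] by eventually_elim simp
    ultimately show ?thesis using *[OF powr(1)] by blast
  next
    case ln
    then have "1 - p > 0" by simp
    then have "((\<lambda>u. - (u powr (1 - p) * ln u)) \<longlongrightarrow> 0) (at_right 0)"
      by real_asymp
    moreover have "\<forall>\<^sub>F u in at_right 0. - (u powr (1 - p) * ln u) \<noteq> 0"
      using eventually_at_right_real[OF zero_less_one] by eventually_elim simp
    ultimately show ?thesis using *[OF ln(3)] by blast
  qed
qed

subsection \<open>Necessity\<close>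

context
  fixes a b c d :: real
  assumes eq: "\<And>x y. x > 0 \<Longrightarrow> y > 0 \<Longrightarrow> gini_mean a b x y + gini_mean c d x y = x + y"
begin

text \<open>Letting \<open>u\<close> tend to 0 in the equation at \<open>(1, u)\<close>. As the
  possible limits are 1, 0 and values strictly between, this excludes most sign patterns.\<close>

lemma gini_limits_add:
  assumes "((\<lambda>u. gini_mean a b 1 u) \<longlongrightarrow> k) (at_right 0)" "((\<lambda>u. gini_mean c d 1 u) \<longlongrightarrow> l) (at_right 0)"
  shows "k + l = 1"
proof -
  have "((\<lambda>u. gini_mean a b 1 u + gini_mean c d 1 u) \<longlongrightarrow> k + l) (at_right 0)"
    by (intro tendsto_add assms)
  moreover have "\<forall>\<^sub>F u in at_right 0. gini_mean a b 1 u + gini_mean c d 1 u = 1 + u"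
    using eventually_at_right_less[of 0] by eventually_elim (simp add: eq)
  ultimately have "((\<lambda>u. 1 + u) \<longlongrightarrow> k + l) (at_right 0)"
    by (rule Lim_transform_eventually)
  moreover have "((\<lambda>u::real. 1 + u) \<longlongrightarrow> 1 + 0) (at_right 0)"
    by (intro tendsto_intros)
  ultimately show ?thesis
    using tendsto_unique[of "at_right (0::real)"] by force
qed

text \<open>Boundary limits rule out \<open>d > 0\<close> and, for \<open>d = 0 < c\<close>, force
  \<open>b = 0\<close>. In the remaining case the second mean tends to 0, so the first tends to 1,
  \<open>b\<close> is positive, and leading terms can be compared.\<close>

lemma matkowski_suto_nonneg:
  assumes "b \<le> a" "d \<le> c" "0 \<le> b" "0 < a"
  shows "a = b + 1 \<and> c = d + 1 \<and> b + d = 0 \<or> a = 3 / 2 \<and> b = 1 / 2 \<and> c + d = 0"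
proof -
  note T2 = matkowski_suto_coefficients(1)[OF eq] and T4 = matkowski_suto_coefficients(2)[OF eq]
  have less1: "(2::real) powr (- 1 / r) < 1" if "r > 0" for r
  proof -
    have "(2::real) powr (- 1 / r) < 2 powr 0"
      using that by (subst powr_less_cancel_iff) (auto simp: divide_neg_pos)
    then show ?thesis by simp
  qed
  have lim0: "((\<lambda>u. gini_mean a b 1 u) \<longlongrightarrow> 2 powr (- 1 / a)) (at_right 0)" if "b = 0"
    using gini_at_0_pos_zero[of a] that assms by simp
  have lim1: "((\<lambda>u. gini_mean a b 1 u) \<longlongrightarrow> 1) (at_right 0)" if "b \<noteq> 0"
    using gini_at_0_pos[of b a] that assms by simp
  consider "d > 0" | "d = 0" "c > 0" | "d < 0 \<or> c = 0"
    using assms by linarith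
  then show ?thesis
  proof cases
    case 1
    then have "((\<lambda>u. gini_mean c d 1 u) \<longlongrightarrow> 1) (at_right 0)"
      using gini_at_0_pos assms by simp
    from gini_limits_add[OF lim0 this] gini_limits_add[OF lim1 this] show ?thesis
      by (cases "b = 0") auto
  next
    case 2
    then have "((\<lambda>u. gini_mean c d 1 u) \<longlongrightarrow> 2 powr (- 1 / c)) (at_right 0)"
      using gini_at_0_pos_zero by simp
    from gini_limits_add[OF lim1 this] have b: "b = 0" by fastforce
    have c: "c = 2 - a" using T2 2 b by simp
    have "a\<^sup>2 / 8 - a * a\<^sup>2 / 12 + ((2 - a)\<^sup>2 / 8 - (2 - a) * (2 - a)\<^sup>2 / 12) = 1 / 12"
      using T4 2 b c by simp
    then have "(a - 1)\<^sup>2 = 0" by (simp add: power2_eq_square field_simps)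
    then show ?thesis using 2 b c by simp
  next
    case 3
    from gini_limits_add[OF lim0 gini_at_0_nonpos[OF assms(2) 3]] less1[OF \<open>0 < a\<close>] have b: "b > 0"
      using assms by fastforce
    \<comment> \<open>The equation at \<open>(1, u)\<close> identifies the two deviations, so an
      asymptotic statement about one transfers to the other under any weight.\<close>
    have f: "\<forall>\<^sub>F u in at_right 0. (1 - gini_mean a b 1 u) / w u = (gini_mean c d 1 u - u) / w u" for w :: "real \<Rightarrow> real"
      using eventually_at_right_less[of 0]
    proof eventually_elim
      case (elim u)
      then have "1 - gini_mean a b 1 u = gini_mean c d 1 u - u" using eq[of 1 u] by simp
      then show ?case by simp
    qed
    from assms(2) 3 show ?thesis
    proof (cases rule: gini_minus_id_cases)
      case (powr x l)
      have "a \<noteq> b"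
      \<comment> \<open>For \<open>a = b\<close> the deviation would have a logarithmic leading
        term, incompatible with the pure power on the other side.\<close>
      proof
        assume "a = b"
        have "((\<lambda>u. (gini_mean c d 1 u - u) / (- (u powr b * ln u))) \<longlongrightarrow> 1) (at_right 0)"
          using Lim_transform_eventually[OF gini_at_0_pos_eq[OF b] f[of "\<lambda>u. - (u powr b * ln u)", unfolded \<open>a = b\<close>]] .
        from powr_ln_comparison[OF powr(1) this] powr show False by simp
      qed
      then have "a > b" using assms by simp
      have "((\<lambda>u. (gini_mean c d 1 u - u) / u powr b) \<longlongrightarrow> 1 / (a - b)) (at_right 0)"
        by (rule Lim_transform_eventually[OF gini_at_0_pos_neq[OF b \<open>a > b\<close>] f])
      from powr_comparison[OF this powr(1)] powr \<open>a > b\<close>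
      have bx: "b = x" "1 / (a - b) = l" by auto
      from powr(4) show ?thesis
      proof (elim disjE conjE)
        assume *: "d < 0" "0 < c" "x = - d / (c - d)" "l = 1"
        have a: "a = b + 1" using bx * \<open>a > b\<close> by (simp add: field_simps)
        have bd: "b * (c - d) = - d" using bx * by simp
        have "c + d = 1 - 2 * b" using T2 a by simp
        then have "(c + d) * (c - d) = c + d" using bd by algebra
        then have "c + d = 0 \<or> c - d = 1" by simp
        then show ?thesis
        proof
          assume "c + d = 0"
          then show ?thesis using \<open>c + d = 1 - 2 * b\<close> a by simp
        next
          assume "c - d = 1"
          then show ?thesis using a bd by simp
        qed
      next
        assume *: "c = 0" "d = 0" "x = 1 / 2" "l = 1"
        then show ?thesis using bx \<open>a > b\<close> by (simp add: field_simps)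
      next
        assume *: "d < c" "c \<le> 0" "x = 1 - c"
        have ab: "b = 1 - c" "a = 1 - d" using bx * T2 by auto
        \<comment> \<open>With b = 1 - c and a = 1 - d, the quartic relation reduces to this
          equation.\<close>
        have "(c - d)\<^sup>2 = 1" using T4 unfolding ab by (simp add: power2_eq_square field_simps)
        then have "c - d = 1" using * by (simp add: power2_eq_1_iff)
        then show ?thesis using ab by simp
      qed
    next
      case ln
      show ?thesis
      proof (cases "a = b")
        case True
        \<comment> \<open>Both sides are logarithmic here, so the coefficient relations decide: the
          quartic one would require (c - d)^2 = 1 although c = d.\<close>
        have *: "b = a" "c = 1 - a" "d = 1 - a" using True ln T2 by simp_all
        show ?thesis using T4 unfolding * by (simp add: power2_eq_square field_simps)
      next
        case False
        then have "a > b" using assms by simp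
        have "((\<lambda>u. (gini_mean c d 1 u - u) / u powr b) \<longlongrightarrow> 1 / (a - b)) (at_right 0)"
          by (rule Lim_transform_eventually[OF gini_at_0_pos_neq[OF b \<open>a > b\<close>] f])
        from powr_ln_comparison[OF this ln(3)] \<open>a > b\<close> show ?thesis by simp
      qed
    qed
  qed
qed

end

text \<open>The equation is symmetric in the two means, so it suffices that one pair is in the range
  of \<open>matkowski_suto_nonneg\<close>. If neither is, both means tend to 0 at the boundary,
  while their sum tends to 1.\<close>

lemma matkowski_suto_sorted:
  assumes eq: "\<And>x y. x > 0 \<Longrightarrow> y > 0 \<Longrightarrow> gini_mean a b x y + gini_mean c d x y = x + y"
    and "b \<le> a" "d \<le> c"
  shows "a = b + 1 \<and> c = d + 1 \<and> b + d = 0 \<or> a = 3 / 2 \<and> b = 1 / 2 \<and> c + d = 0 \<or>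
    c = 3 / 2 \<and> d = 1 / 2 \<and> a + b = 0"
proof -
  have eq': "gini_mean c d x y + gini_mean a b x y = x + y" if "x > 0" "y > 0" for x y
    using eq[OF that] by simp
  consider "0 \<le> b" "0 < a" | "0 \<le> d" "0 < c" | "b < 0 \<or> a = 0" "d < 0 \<or> c = 0"
    using assms by linarith
  then show ?thesis
  proof cases
    case 1
    then show ?thesis using matkowski_suto_nonneg[OF eq] assms by blast
  next
    case 2
    then show ?thesis using matkowski_suto_nonneg[OF eq'] assms by (auto simp: add.commute)
  next
    case 3
    then show ?thesis using gini_limits_add[OF eq gini_at_0_nonpos gini_at_0_nonpos] assms by auto
  qed
qed

subsection \<open>The solutions\<close>

lemma gini_mean_max_min: "gini_mean (max p q) (min p q) = gini_mean p q"
  by (auto simp: max_def min_def fun_eq_iff gini_mean_commute)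

lemma gini_mean_cong_set: "{p, q} = {r, s} \<Longrightarrow> gini_mean p q = gini_mean r s"
  by (auto simp: doubleton_eq_iff fun_eq_iff gini_mean_commute)

text \<open>The outer exponent is 1, leaving the arithmetic mean of x and y with weights
  \<open>x powr v\<close> and \<open>y powr v\<close> (a Lehmer mean).\<close>

lemma gini_mean_add_1:
  assumes "x > 0" "y > 0"
  shows "gini_mean (1 + v) v x y = (x * x powr v + y * y powr v) / (x powr v + y powr v)"
  using assms add_pos_pos[of "x powr v" "y powr v"]
  by (simp add: gini_mean_def powr_add)

text \<open>Rests on x^p + y^p = (x y)^p (x^(-p) + y^(-p)).\<close>

lemma gini_mean_geometric:
  assumes "x > 0" "y > 0" "p + q = 0"
  shows "gini_mean p q x y = geometric_mean x y"
proof -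
  have q: "q = - p" using assms by simp
  have sqrt: "sqrt (x * y) = (x * y) powr (1 / 2)"
    using assms by (simp add: powr_half_sqrt)
  show ?thesis
  proof (cases "p = 0")
    case True
    then show ?thesis
      using assms by (simp add: geometric_mean_def gini_mean_def sqrt powr_def ln_mult)
  next
    case False
    have "x powr p + y powr p > 0" using assms by (simp add: add_pos_pos)
    then have "(x powr p + y powr p) / (x powr q + y powr q) = (x * y) powr p"
      using assms by (simp add: q powr_minus powr_mult divide_simps)
    then show ?thesis
      using False assms by (simp add: geometric_mean_def gini_mean_def sqrt q powr_powr)
  qed
qed

text \<open>In terms of the square roots s and t, this is (s^3 + t^3)/(s + t) = s^2 - s t +
  t^2.\<close>

lemma gini_mean_three_halves:
  assumes "x > 0" "y > 0"
  shows "gini_mean (3/2) (1/2) x y + geometric_mean x y = x + y"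
proof -
  define s t where "s = sqrt x" and "t = sqrt y"
  have st: "s > 0" "t > 0" "x = s^2" "y = t^2" using assms by (auto simp: s_def t_def)
  have "gini_mean (3/2) (1/2) x y = (s^2 * s + t^2 * t) / (s + t)"
    using gini_mean_add_1[OF assms, of "1/2"] assms by (simp add: powr_half_sqrt s_def t_def)
  moreover have "geometric_mean x y = s * t"
    by (simp add: geometric_mean_def s_def t_def real_sqrt_mult)
  moreover have "(s^2 * s + t^2 * t) / (s + t) + s * t = s^2 + t^2"
    using st by (simp add: divide_simps) (simp add: algebra_simps power2_eq_square)
  ultimately show ?thesis using st by simp
qed

text \<open>Replacing v by -v inverts the weights, which after normalisation swaps them; the two
  weighted means then add up to x + y.\<close>

lemma gini_mean_complementary:
  assumes "x > 0" "y > 0"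
  shows "gini_mean (1 + v) v x y + gini_mean (1 - v) (- v) x y = x + y"
proof -
  define s t where "s = x powr v" and "t = y powr v"
  have st: "s > 0" "t > 0" using assms by (auto simp: s_def t_def)
  then have "s + t > 0" by simp
  have "gini_mean (1 + v) v x y = (x * s + y * t) / (s + t)"
    using gini_mean_add_1[OF assms] by (simp add: s_def t_def)
  moreover have "gini_mean (1 - v) (- v) x y = (x / s + y / t) / (1 / s + 1 / t)"
    using gini_mean_add_1[OF assms, of "- v"] by (simp add: s_def t_def powr_minus_divide)
  moreover have "(x / s + y / t) / (1 / s + 1 / t) = (x * t + y * s) / (s + t)"
    using st \<open>s + t > 0\<close> by (simp add: divide_simps)
  moreover have "(x * s + y * t) / (s + t) + (x * t + y * s) / (s + t) = x + y"
    using \<open>s + t > 0\<close> by (simp add: divide_simps) (simp add: algebra_simps)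
  ultimately show ?thesis by (simp only:)
qed

theorem mainTheorem2:
  fixes a b c d :: real
  shows "((\<forall>x>0. \<forall>y>0. gini_mean a b x y + gini_mean c d x y = x + y) \<longleftrightarrow>
           ({a, b} = {c, d} \<and> {c, d} = {1, 0}) \<or>
           (\<exists>v::real. {a, b} = {1 + v, v} \<and> {c, d} = {1 - v, - v}) \<or>
           ({a, b} = {3/2, 1/2} \<and> c + d = 0) \<or>
           (a + b = 0 \<and> {c, d} = {3/2, 1/2}))
       \<and> ({a, b} = {c, d} \<and> {c, d} = {1, 0} \<longrightarrow>
           (\<forall>x>0. \<forall>y>0. gini_mean a b x y = arithmetic_mean x y \<and>
                          gini_mean c d x y = arithmetic_mean x y))
       \<and> ({a, b} = {3/2, 1/2} \<and> c + d = 0 \<longrightarrow>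
           (\<forall>x>0. \<forall>y>0. gini_mean c d x y = geometric_mean x y))
       \<and> (a + b = 0 \<and> {c, d} = {3/2, 1/2} \<longrightarrow>
           (\<forall>x>0. \<forall>y>0. gini_mean a b x y = geometric_mean x y))"
    (is "(?eq \<longleftrightarrow> ?i \<or> ?ii \<or> ?iii \<or> ?iv) \<and> _")
proof -
  have arith: "gini_mean p q x y = arithmetic_mean x y" if "{p, q} = {1, 0}" "x > 0" "y > 0" for p q x y
    using gini_mean_add_1[of x y 0] gini_mean_cong_set[OF that(1)] that by (simp add: arithmetic_mean_def)
  have "?i \<or> ?ii \<or> ?iii \<or> ?iv" if ?eq
  proof -
    \<comment> \<open>Sorting each pair is harmless because the mean is symmetric in its parameters,
      and the conclusion depends only on the sets and the sums.\<close>
    define A B C D where "A = max a b" and "B = min a b" and "C = max c d" and "D = min c d"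
    have sets: "{a, b} = {A, B}" "{c, d} = {C, D}" and sums: "a + b = A + B" "c + d = C + D"
      by (auto simp: A_def B_def C_def D_def max_def min_def)
    have "gini_mean A B x y + gini_mean C D x y = x + y" if "x > 0" "y > 0" for x y
      using \<open>?eq\<close> that by (simp add: A_def B_def C_def D_def gini_mean_max_min)
    then have "A = B + 1 \<and> C = D + 1 \<and> B + D = 0 \<or> A = 3 / 2 \<and> B = 1 / 2 \<and> C + D = 0 \<or>
        C = 3 / 2 \<and> D = 1 / 2 \<and> A + B = 0"
      by (intro matkowski_suto_sorted) (auto simp: A_def B_def C_def D_def)
    then show ?thesis
    proof (elim disjE)
      assume "A = B + 1 \<and> C = D + 1 \<and> B + D = 0"
      then have "A = 1 + B" "C = 1 - B" "D = - B" by auto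
      then have ?ii unfolding sets by (intro exI[of _ B]) simp
      then show ?thesis by blast
    qed (auto simp: sets sums)
  qed
  moreover have ?eq if "?i \<or> ?ii \<or> ?iii \<or> ?iv"
  proof (intro allI impI)
    fix x y :: real
    assume xy: "x > 0" "y > 0"
    from that show "gini_mean a b x y + gini_mean c d x y = x + y"
    proof (elim disjE exE conjE)
      assume "{a, b} = {c, d}" "{c, d} = {1, 0}"
      then show ?thesis using arith[of a b x y] arith[of c d x y] xy by (simp add: arithmetic_mean_def)
    next
      fix v
      assume sets: "{a, b} = {1 + v, v}" "{c, d} = {1 - v, - v}"
      show ?thesis
        using gini_mean_complementary[OF xy, of v] by (simp add: sets[THEN gini_mean_cong_set])
    next
      assume *: "{a, b} = {3/2, 1/2}" "c + d = 0"
      show ?thesis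
        using gini_mean_three_halves[OF xy] gini_mean_geometric[OF xy *(2)]
        by (simp add: gini_mean_cong_set[OF *(1)])
    next
      assume *: "a + b = 0" "{c, d} = {3/2, 1/2}"
      show ?thesis
        using gini_mean_three_halves[OF xy] gini_mean_geometric[OF xy *(1)]
        by (simp add: gini_mean_cong_set[OF *(2)])
    qed
  qed
  ultimately have "?eq \<longleftrightarrow> ?i \<or> ?ii \<or> ?iii \<or> ?iv" by (rule iffI)
  then show ?thesis
    using arith gini_mean_geometric by simp
qed

end
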